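(* Let $D$ be a weighted digraph (without multiple arcs, loops allowed) with $n\geq 1$ vertices and $r$ loops. If $d^{w+}(v)\geq 1$ for every vertex $v\in V(D)$, then $D$ contains a directed cycle $C$ such that $w(C)\geq \dfrac{1}{\log_2 (n+r)}$.
   Context: All digraphs are finite and contain no multiple arcs: for each ordered pair $(u,v)$ of vertices (including $u=v$) there is at most one arc $uv$ from $u$ to $v$ (both $uv$ and $vu$ may be present). A loop is an arc $vv$; loops are allowed, with at most one loop at each vertex. $V(D)$ and $A(D)$ denote the sets of vertices and arcs of $D$. A weighted digraph is a digraph $D$ in which each arc $a$ is assigned a nonnegative real number $w(a)$, its weight. For a vertex $v$, $N^+(v)$ is the set of vertices to which there is an arc from $v$ (so $v\in N^+(v)$ if $vv$ is a loop of $D$), and the weighted outdegree of $v$ is $d^{w+}(v)=\sum_{u\in N^+(v)} w(vu)$; in particular a loop at $v$ contributes its weight to $d^{w+}(v)$. The weight of a subdigraph $H$ of $D$ is $w(H)=\sum_{a\in A(H)} w(a)$. A directed cycle is a subdigraph consisting of distinct vertices $v_1,\dots,v_k$ ($k\geq 1$) and the arcs $v_1v_2,\dots,v_{k-1}v_k,v_kv_1$; a loop $vv$ is a directed cycle (the case $k=1$), and $k=2$ is also allowed. *)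

theory Defs
  imports Complex_Main "Graph_Theory.Pair_Digraph" "Graph_Theory.Arc_Walk"
begin

text \<open>
  Arcs of a \<^typ>\<open>'a pair_pre_digraph\<close> are ordered pairs of vertices, so multiple arcs are
  excluded by the representation, while loops are permitted.
\<close>

definition out_neighbours :: "'a pair_pre_digraph \<Rightarrow> 'a \<Rightarrow> 'a set" where
  "out_neighbours D v = {u. (v, u) \<in> parcs D}"

definition weighted_outdegree :: "'a pair_pre_digraph \<Rightarrow> ('a \<times> 'a \<Rightarrow> real) \<Rightarrow> 'a \<Rightarrow> real" where
  "weighted_outdegree D w v = (\<Sum>u\<in>out_neighbours D v. w (v, u))"

definition loops :: "'a pair_pre_digraph \<Rightarrow> ('a \<times> 'a) set" where
  "loops D = {a \<in> parcs D. fst a = snd a}"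

text \<open>
  A directed cycle is given by its list of arcs in the sense of \<^const>\<open>pre_digraph.cycle\<close>,
  which includes loops (length 1) and cycles of length 2. Its weight is the sum over the arc set
  of the corresponding subdigraph.
\<close>

definition directed_cycle :: "'a pair_pre_digraph \<Rightarrow> ('a \<times> 'a) list \<Rightarrow> bool" where
  "directed_cycle D C \<longleftrightarrow> pre_digraph.cycle (with_proj D) C"

definition cycle_weight :: "('a \<times> 'a \<Rightarrow> real) \<Rightarrow> ('a \<times> 'a) list \<Rightarrow> real" where
  "cycle_weight w C = (\<Sum>a\<in>set C. w a)"

end

theory Submission
  imports Defs
begin

text \<open>
  Regard non-arcs as arcs of weight 0, let all weighted outdegrees be at least \<open>d\<close> and all cycles
  of weight at most \<open>W\<close>; then \<open>d \<le> W log\<^sub>2 (n + r)\<close>. Suppose first that some vertex \<open>x\<close> carries no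
  loop. If \<open>x\<close> has no incoming arc, delete it. Otherwise contract the heaviest arc \<open>vx\<close> entering
  \<open>x\<close>: delete \<open>v\<close> and reroute every arc \<open>uv\<close> to an arc \<open>ux\<close> of weight \<open>w(uv) + w(vx)\<close>. By the
  choice of \<open>v\<close> this replaces an arc \<open>ux\<close> of weight at most \<open>w(vx)\<close>, so no outdegree drops; a cycle
  uses at most one arc into \<open>x\<close>, so it lifts to a cycle of the same weight; and since a loop can
  only be created at \<open>x\<close>, \<open>n + r\<close> does not grow. Once every vertex carries a loop, remove
  all loops: \<open>d\<close> drops by at most \<open>W\<close>, while \<open>n + r\<close> is halved.
\<close>

section \<open>Cycles as cyclic vertex lists\<close>

definition cyclic_arcs :: "'a list \<Rightarrow> ('a \<times> 'a) list" where
  "cyclic_arcs c = zip c (rotate1 c)"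

text \<open>The weight function also encodes the arc set: weight 0 means that the arc is absent, so
  deleting an arc amounts to setting its weight to 0.\<close>

definition positive_cycle :: "'a set \<Rightarrow> ('a \<times> 'a \<Rightarrow> real) \<Rightarrow> 'a list \<Rightarrow> bool" where
  "positive_cycle V w c \<longleftrightarrow>
    c \<noteq> [] \<and> distinct c \<and> set c \<subseteq> V \<and> (\<forall>a\<in>set (cyclic_arcs c). 0 < w a)"

definition cyclic_weight :: "('a \<times> 'a \<Rightarrow> real) \<Rightarrow> 'a list \<Rightarrow> real" where
  "cyclic_weight w c = sum_list (map w (cyclic_arcs c))"

definition cycles_bounded :: "'a set \<Rightarrow> ('a \<times> 'a \<Rightarrow> real) \<Rightarrow> real \<Rightarrow> bool" where
  "cycles_bounded V w W \<longleftrightarrow> (\<forall>c. positive_cycle V w c \<longrightarrow> cyclic_weight w c \<le> W)"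

definition loop_vertices :: "'a set \<Rightarrow> ('a \<times> 'a \<Rightarrow> real) \<Rightarrow> 'a set" where
  "loop_vertices V w = {v \<in> V. 0 < w (v, v)}"

text \<open>In both orders every vertex has the same successor; \<open>p\<close> holds the arcs
  leaving \<open>a\<close> and \<open>q\<close> those leaving \<open>b\<close>.\<close>

lemma cyclic_arcs_rotate:
  assumes "a \<noteq> []" and "b \<noteq> []"
  shows "\<exists>p q. cyclic_arcs (a @ b) = p @ q \<and> cyclic_arcs (b @ a) = q @ p"
proof -
  obtain x a' where a: "a = x # a'" using assms(1) by (cases a) auto
  obtain y b' where b: "b = y # b'" using assms(2) by (cases b) auto
  have "cyclic_arcs (a @ b) = zip a (a' @ [y]) @ zip b (b' @ [x])"
    unfolding cyclic_arcs_def a b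
    using zip_append[of "x # a'" "a' @ [y]" "y # b'" "b' @ [x]"] by simp
  moreover have "cyclic_arcs (b @ a) = zip b (b' @ [x]) @ zip a (a' @ [y])"
    unfolding cyclic_arcs_def a b
    using zip_append[of "y # b'" "b' @ [x]" "x # a'" "a' @ [y]"] by simp
  ultimately show ?thesis by blast
qed

text \<open>With \<open>x\<close> at the head, the one arc of the cycle that enters \<open>x\<close>
  is the closing arc.\<close>

lemma rotate_to_head:
  assumes "positive_cycle V w c" and "x \<in> set c"
  obtains p where "positive_cycle V w (x # p)" and "cyclic_weight w (x # p) = cyclic_weight w c"
proof -
  obtain a b where c: "c = a @ x # b" using assms(2) by (meson split_list)
  show ?thesis
  proof (cases "a = []")
    case True
    then show ?thesis using that assms(1) c by auto
  next
    case False
    obtain p q where "cyclic_arcs (a @ x # b) = p @ q" "cyclic_arcs ((x # b) @ a) = q @ p"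
      using cyclic_arcs_rotate[OF False, of "x # b"] by blast
    then show ?thesis
      using that[of "b @ a"] assms(1)
      unfolding c positive_cycle_def cyclic_weight_def by auto
  qed
qed

lemma set_cyclic_arcs_subset: "set (cyclic_arcs c) \<subseteq> set c \<times> set c"
  by (auto simp: cyclic_arcs_def dest: set_zip_leftD set_zip_rightD)

text \<open>Prepares the lifting of cycles: the two arc lists differ only in the closing arc, which
  is replaced by the detour through \<open>v\<close>.\<close>

lemma cyclic_arcs_snoc:
  assumes "c = b @ [l]" and "c = x # p"
  shows "cyclic_arcs c = zip b p @ [(l, x)]"
    and "cyclic_arcs (c @ [v]) = zip b p @ [(l, v), (v, x)]"
proof -
  have len: "length b = length p"
    using assms by (metis length_append_singleton length_Cons nat.inject)
  have "cyclic_arcs c = zip (b @ [l]) (p @ [x])"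
    unfolding cyclic_arcs_def using assms by (metis rotate1.simps(2))
  then show "cyclic_arcs c = zip b p @ [(l, x)]" using len by simp
  have "cyclic_arcs (c @ [v]) = zip ((b @ [l]) @ [v]) ((p @ [v]) @ [x])"
    unfolding cyclic_arcs_def using assms by (metis append_Cons rotate1.simps(2))
  then show "cyclic_arcs (c @ [v]) = zip b p @ [(l, v), (v, x)]" using len by simp
qed

text \<open>Serves both for deleting a vertex and for removing the loops: surviving arcs keep their
  weight, so no new cycle arises.\<close>

lemma cycles_bounded_mono:
  assumes "cycles_bounded V w W" and "V' \<subseteq> V"
    and "\<And>a. a \<in> V' \<times> V' \<Longrightarrow> 0 < w' a \<Longrightarrow> w' a = w a"
  shows "cycles_bounded V' w' W"
  unfolding cycles_bounded_def
proof (intro allI impI)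
  fix c assume c: "positive_cycle V' w' c"
  have eq: "w' a = w a" if "a \<in> set (cyclic_arcs c)" for a
    using that c set_cyclic_arcs_subset[of c] assms(3)
    unfolding positive_cycle_def by blast
  have "positive_cycle V w c"
    using c eq assms(2) unfolding positive_cycle_def by fastforce
  moreover have "cyclic_weight w' c = cyclic_weight w c"
    unfolding cyclic_weight_def using eq by (metis map_eq_conv)
  ultimately show "cyclic_weight w' c \<le> W"
    using assms(1) unfolding cycles_bounded_def by simp
qed

section \<open>Contraction of an arc\<close>

definition contract :: "('a \<times> 'a \<Rightarrow> real) \<Rightarrow> 'a \<Rightarrow> 'a \<Rightarrow> 'a \<times> 'a \<Rightarrow> real" where
  "contract w v x = (\<lambda>(a, b). if b = x \<and> 0 < w (a, v) then w (a, v) + w (v, x) else w (a, b))"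

text \<open>Only the arc entering \<open>x\<close> can have changed. If it was rerouted, inserting
  \<open>v\<close> before \<open>x\<close> restores the original arcs, and the cycle stays simple
  because \<open>v\<close> was deleted. A new loop at \<open>x\<close> lifts to a 2-cycle in this
  way.\<close>

lemma cycles_bounded_contract:
  assumes bnd: "cycles_bounded V w W" and v: "v \<in> V" and pos: "0 < w (v, x)"
  shows "cycles_bounded (V - {v}) (contract w v x) W"
  unfolding cycles_bounded_def
proof (intro allI impI)
  let ?w = "contract w v x"
  fix c assume c: "positive_cycle (V - {v}) ?w c"
  show "cyclic_weight ?w c \<le> W"
  proof (cases "x \<in> set c")
    case False
    have eq: "?w a = w a" if "a \<in> set (cyclic_arcs c)" for a
      using that False set_cyclic_arcs_subset[of c] unfolding contract_def by auto
    have "positive_cycle V w c"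
      using c eq unfolding positive_cycle_def by fastforce
    moreover have "cyclic_weight ?w c = cyclic_weight w c"
      unfolding cyclic_weight_def using eq by (metis map_eq_conv)
    ultimately show ?thesis using bnd unfolding cycles_bounded_def by simp
  next
    case True
    obtain p where p: "positive_cycle (V - {v}) ?w (x # p)"
      and wt: "cyclic_weight ?w (x # p) = cyclic_weight ?w c"
      using rotate_to_head[OF c True] .
    obtain b l where bl: "x # p = b @ [l]" by (metis list.distinct(1) rev_exhaust)
    note arcs = cyclic_arcs_snoc[OF bl refl]
    \<comment> \<open>All arcs of the cycle but the closing one end in \<open>p\<close>, hence not
      in \<open>x\<close>, and are untouched by the contraction.\<close>
    have "x \<notin> set p" using p unfolding positive_cycle_def by simp
    then have eq: "?w a = w a" if "a \<in> set (zip b p)" for a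
      using that set_zip_rightD[of "fst a" "snd a" b p] unfolding contract_def
      by (auto split: prod.splits)
    have map_eq: "map ?w (zip b p) = map w (zip b p)" using eq by simp
    have mem: "x # p \<noteq> []" "distinct (x # p)" "set (x # p) \<subseteq> V" "v \<notin> set (x # p)"
      using p unfolding positive_cycle_def by auto
    have inner: "0 < w a" if "a \<in> set (zip b p)" for a
      using p eq[OF that] that unfolding positive_cycle_def arcs by auto
    have last: "0 < ?w (l, x)"
      using p unfolding positive_cycle_def arcs by auto
    show ?thesis
    proof (cases "0 < w (l, v)")
      case True
      have "positive_cycle V w ((x # p) @ [v])"
        using mem v inner pos True unfolding positive_cycle_def arcs by auto
      moreover have "cyclic_weight w ((x # p) @ [v]) = cyclic_weight ?w (x # p)"
        unfolding cyclic_weight_def arcs map_append map_eq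
        using True by (simp add: contract_def)
      ultimately show ?thesis using bnd wt unfolding cycles_bounded_def by metis
    next
      case False
      then have same: "?w (l, x) = w (l, x)" by (simp add: contract_def)
      have "positive_cycle V w (x # p)"
        using mem inner last same unfolding positive_cycle_def arcs by auto
      moreover have "cyclic_weight w (x # p) = cyclic_weight ?w (x # p)"
        unfolding cyclic_weight_def arcs map_append map_eq using same by simp
      ultimately show ?thesis using bnd wt unfolding cycles_bounded_def by metis
    qed
  qed
qed

text \<open>The arcs from \<open>a\<close> to \<open>v\<close> and \<open>x\<close> merge into one.
  If \<open>w (a, v)\<close> is positive, \<open>w (v, x)\<close> makes up for the lost
  \<open>w (a, x)\<close>; otherwise \<open>w (a, v) = 0\<close> and nothing is lost.\<close>

lemma outdegree_contract:
  assumes fin: "finite V" and "v \<in> V" "x \<in> V" "v \<noteq> x"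
    and nonneg: "\<And>b. b \<in> V \<Longrightarrow> 0 \<le> w (a, b)" and max: "w (a, x) \<le> w (v, x)"
  shows "(\<Sum>b\<in>V. w (a, b)) \<le> (\<Sum>b\<in>V - {v}. contract w v x (a, b))"
proof -
  have "(\<Sum>b\<in>V. w (a, b)) = w (a, v) + w (a, x) + (\<Sum>b\<in>V - {v} - {x}. w (a, b))"
    using assms by (simp add: sum.remove[of V v] sum.remove[of "V - {v}" x])
  moreover have "(\<Sum>b\<in>V - {v}. contract w v x (a, b))
      = contract w v x (a, x) + (\<Sum>b\<in>V - {v} - {x}. contract w v x (a, b))"
    using assms by (simp add: sum.remove[of "V - {v}" x])
  moreover have "(\<Sum>b\<in>V - {v} - {x}. contract w v x (a, b)) = (\<Sum>b\<in>V - {v} - {x}. w (a, b))"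
    by (intro sum.cong) (auto simp: contract_def)
  moreover have "w (a, v) + w (a, x) \<le> contract w v x (a, x)"
    using max nonneg[OF \<open>v \<in> V\<close>] by (auto simp: contract_def)
  ultimately show ?thesis by linarith
qed

lemma loop_vertices_contract:
  "loop_vertices (V - {v}) (contract w v x) \<subseteq> insert x (loop_vertices V w)"
  by (auto simp: loop_vertices_def contract_def)

section \<open>The logarithmic bound by induction\<close>

lemma outdegree_le_log:
  fixes w :: "'a \<times> 'a \<Rightarrow> real"
  assumes "finite V" and "V \<noteq> {}" and "\<And>a. a \<in> V \<times> V \<Longrightarrow> 0 \<le> w a"
    and "0 \<le> W" and "cycles_bounded V w W"
    and "\<And>v. v \<in> V \<Longrightarrow> d \<le> (\<Sum>u\<in>V. w (v, u))"
  shows "d \<le> W * log 2 (real (card V + card (loop_vertices V w)))"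
  using assms
\<comment> \<open>A contraction may trade a vertex for a loop and leave \<open>n + r\<close>
  unchanged, so vertices count twice in the measure. The bound \<open>d\<close> varies because
  removing loops lowers it to \<open>d - W\<close>.\<close>
proof (induction "2 * card V + card (loop_vertices V w)" arbitrary: V w d rule: less_induct)
  case less
  note fin = less.prems(1) and ne = less.prems(2) and nonneg = less.prems(3)
    and bnd = less.prems(5) and out = less.prems(6)
  let ?m = "\<lambda>V w. card V + card (loop_vertices V w)"
  have fin_loops: "finite (loop_vertices V w)" using fin by (simp add: loop_vertices_def)
  have log_mono: "W * log 2 (real k) \<le> W * log 2 (real (?m V w))" if "0 < k" "k \<le> ?m V w" for k
    using that \<open>0 \<le> W\<close> by (intro mult_left_mono) auto
  have card_pos: "0 < card V" using fin ne by (simp add: card_gt_0_iff)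
  show ?case
  proof (cases "loop_vertices V w = V")
    case True
    define w' where "w' = (\<lambda>(a, b). if a = b then 0 else w (a, b))"
    have no_loops: "loop_vertices V w' = {}" by (auto simp: loop_vertices_def w'_def)
    have "d - W \<le> (\<Sum>u\<in>V. w' (v, u))" if v: "v \<in> V" for v
    proof -
      \<comment> \<open>The loop is itself a cycle, so its weight is at most
        \<open>W\<close>.\<close>
      have "positive_cycle V w [v]"
        using v True by (auto simp: positive_cycle_def cyclic_arcs_def loop_vertices_def)
      then have "cyclic_weight w [v] \<le> W" using bnd by (simp add: cycles_bounded_def)
      then have "w (v, v) \<le> W" by (simp add: cyclic_weight_def cyclic_arcs_def)
      moreover have "(\<Sum>u\<in>V - {v}. w' (v, u)) = (\<Sum>u\<in>V - {v}. w (v, u))"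
        by (intro sum.cong) (auto simp: w'_def)
      moreover have "(\<Sum>u\<in>V. w' (v, u)) = (\<Sum>u\<in>V - {v}. w' (v, u))"
        using fin v by (simp add: sum.remove[of V v] w'_def)
      moreover have "(\<Sum>u\<in>V. w (v, u)) = w (v, v) + (\<Sum>u\<in>V - {v}. w (v, u))"
        using fin v by (simp add: sum.remove[of V v])
      ultimately show ?thesis using out[OF v] by linarith
    qed
    moreover have "cycles_bounded V w' W"
      by (rule cycles_bounded_mono[OF bnd]) (auto simp: w'_def split: if_splits)
    moreover have "0 \<le> w' a" if "a \<in> V \<times> V" for a
      using nonneg[OF that] by (auto simp: w'_def split: prod.split)
    ultimately have "d - W \<le> W * log 2 (real (card V))"
      using less.hyps[of V w' "d - W"] True no_loops fin ne card_pos \<open>0 \<le> W\<close>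
      by simp
    \<comment> \<open>Here \<open>n + r = 2 * n\<close>; the additional 1 in the logarithm pays for
      the lost \<open>W\<close>.\<close>
    moreover have "log 2 (real (card V + card V)) = 1 + log 2 (real (card V))"
      using card_pos log_mult[of 2 "real (card V)" 2] by (simp add: mult.commute)
    ultimately show ?thesis using True by (simp add: algebra_simps)
  next
    case False
    then obtain x where x: "x \<in> V" "x \<notin> loop_vertices V w" by (auto simp: loop_vertices_def)
    have x0: "w (x, x) = 0"
      using x nonneg[of "(x, x)"] by (auto simp: loop_vertices_def)
    show ?thesis
    proof (cases "\<exists>u\<in>V. 0 < w (u, x)")
      case no_in: False
      have in0: "w (u, x) = 0" if "u \<in> V" for u
        using no_in that nonneg[of "(u, x)"] x(1) by force
      have out': "d \<le> (\<Sum>u\<in>V - {x}. w (v, u))" if "v \<in> V" for v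
        using out[OF that] fin x(1) in0[OF that] by (simp add: sum.remove[of V x])
      show ?thesis
      proof (cases "V = {x}")
        case True
        \<comment> \<open>The base case: a single vertex without a loop has outdegree 0.\<close>
        then have "d \<le> 0" using out'[OF x(1)] by simp
        moreover have "0 \<le> W * log 2 (real (?m V w))"
          using log_mono[of 1] card_pos by simp
        ultimately show ?thesis by linarith
      next
        case not_single: False
        have ne': "V - {x} \<noteq> {}" using not_single ne by blast
        have c1: "card (V - {x}) = card V - 1" using fin x(1) by simp
        have c2: "card (loop_vertices (V - {x}) w) \<le> card (loop_vertices V w)"
          using fin_loops by (intro card_mono) (auto simp: loop_vertices_def)
        have "d \<le> W * log 2 (real (?m (V - {x}) w))"
        proof (rule less.hyps)
          show "2 * card (V - {x}) + card (loop_vertices (V - {x}) w)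
              < 2 * card V + card (loop_vertices V w)"
            using c1 c2 card_pos by linarith
          show "cycles_bounded (V - {x}) w W" by (rule cycles_bounded_mono[OF bnd]) auto
        qed (use fin ne' nonneg out' \<open>0 \<le> W\<close> in auto)
        also have "\<dots> \<le> W * log 2 (real (?m V w))"
          using c1 c2 ne' fin by (intro log_mono) (auto simp: card_gt_0_iff)
        finally show ?thesis .
      qed
    next
      case True
      let ?M = "Max ((\<lambda>u. w (u, x)) ` V)"
      have "?M \<in> (\<lambda>u. w (u, x)) ` V" using fin ne by (intro Max_in) auto
      then obtain v where v: "v \<in> V" and vM: "w (v, x) = ?M" by auto
      have max: "w (u, x) \<le> w (v, x)" if "u \<in> V" for u
        using that fin unfolding vM by (intro Max_ge) auto
      have pos: "0 < w (v, x)" using True max by force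
      \<comment> \<open>As \<open>x\<close> has no loop, it survives the deletion of
        \<open>v\<close>.\<close>
      have vx: "v \<noteq> x" using pos x0 by auto
      let ?w = "contract w v x"
      have c1: "card (V - {v}) = card V - 1" using fin v by simp
      have c2: "card (loop_vertices (V - {v}) ?w) \<le> Suc (card (loop_vertices V w))"
        using card_mono[OF _ loop_vertices_contract[of V v w x]] fin_loops x(2) by simp
      have "d \<le> W * log 2 (real (?m (V - {v}) ?w))"
      proof (rule less.hyps)
        show "2 * card (V - {v}) + card (loop_vertices (V - {v}) ?w)
            < 2 * card V + card (loop_vertices V w)"
          using c1 c2 card_pos by linarith
        show "cycles_bounded (V - {v}) ?w W" by (rule cycles_bounded_contract[OF bnd v pos])
        show "V - {v} \<noteq> {}" using x(1) vx by blast
        show "0 \<le> ?w a" if "a \<in> (V - {v}) \<times> (V - {v})" for a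
          using nonneg[of a] pos that by (auto simp: contract_def split: prod.split)
        show "d \<le> (\<Sum>u\<in>V - {v}. ?w (a, u))" if "a \<in> V - {v}" for a
          using outdegree_contract[of V v x w a] out[of a] that fin v x(1) vx nonneg max
          by fastforce
      qed (use fin \<open>0 \<le> W\<close> in auto)
      also have "\<dots> \<le> W * log 2 (real (?m V w))"
      proof (rule log_mono)
        have "0 < card (V - {v})" using fin x(1) vx by (auto simp: card_gt_0_iff)
        then show "0 < ?m (V - {v}) ?w" by simp
        show "?m (V - {v}) ?w \<le> ?m V w" using c1 c2 card_pos by linarith
      qed
      finally show ?thesis .
    qed
  qed
qed

section \<open>From vertex lists to directed cycles of the digraph\<close>

lemma awalk_verts_zip:
  "pre_digraph.awalk_verts (with_proj D) u (zip (u # q) (q @ [z])) = u # q @ [z]"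
  by (induction q arbitrary: u) (auto simp: pre_digraph.awalk_verts.simps
    simp del: awalk_verts_with_proj_eq)

text \<open>The end \<open>z\<close> is independent of \<open>u\<close> because the induction
  advances the start; closed walks are the case \<open>z = u\<close>.\<close>

lemma cas_zip: "pre_digraph.cas (with_proj D) u (zip (u # q) (q @ [z])) z"
  by (induction q arbitrary: u) (auto simp: pre_digraph.cas.simps simp del: cas_with_proj_eq)

lemma directed_cycle_cyclic_arcs:
  assumes "c \<noteq> []" and "distinct c" and "set c \<subseteq> pverts D" and "set (cyclic_arcs c) \<subseteq> parcs D"
  shows "directed_cycle D (cyclic_arcs c)"
proof -
  obtain u q where c: "c = u # q" using assms(1) by (cases c) auto
  then have arcs: "cyclic_arcs c = zip (u # q) (q @ [u])" by (simp add: cyclic_arcs_def)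
  have "pre_digraph.awalk (with_proj D) u (cyclic_arcs c) u"
    using assms(3,4) cas_zip[of D u q u] c arcs
    unfolding pre_digraph.awalk_def by simp
  moreover have "distinct (tl (pre_digraph.awalk_verts (with_proj D) u (cyclic_arcs c)))"
    unfolding arcs awalk_verts_zip using assms(2) c by simp
  moreover have "cyclic_arcs c \<noteq> []" using arcs by (cases q) auto
  ultimately show ?thesis
    unfolding directed_cycle_def pre_digraph.cycle_def by blast
qed

theorem theorem3:
  fixes D :: "'a pair_pre_digraph" and w :: "'a \<times> 'a \<Rightarrow> real" and n r :: nat
  assumes "pair_fin_digraph D"
    and "\<And>a. a \<in> parcs D \<Longrightarrow> w a \<ge> 0"
    and "n = card (pverts D)" and "n \<ge> 1"
    and "r = card (loops D)"
    and "\<And>v. v \<in> pverts D \<Longrightarrow> weighted_outdegree D w v \<ge> 1"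
  shows "\<exists>C. directed_cycle D C \<and> cycle_weight w C \<ge> 1 / log 2 (real (n + r))"
proof -
  interpret pair_fin_digraph D by fact
  let ?V = "pverts D"
  define w0 where "w0 a = (if a \<in> parcs D then w a else 0)" for a
  define S where "S = {c. positive_cycle ?V w0 c}"
  \<comment> \<open>The inserted 0 keeps the maximum defined when there is no positive
    cycle.\<close>
  define W where "W = Max (insert 0 (cyclic_weight w0 ` S))"
  have "S \<subseteq> {c. set c \<subseteq> ?V \<and> distinct c}"
    by (auto simp: S_def positive_cycle_def)
  then have fin_S: "finite S"
    using finite_subset finite_subset_distinct[OF pair_finite_verts] by blast
  have W0: "0 \<le> W" unfolding W_def using fin_S by simp
  have bnd: "cycles_bounded ?V w0 W"
    unfolding cycles_bounded_def W_def using fin_S by (auto simp: S_def)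
  have out: "1 \<le> (\<Sum>u\<in>?V. w0 (v, u))" if "v \<in> ?V" for v
  proof -
    have "(\<Sum>u\<in>?V. w0 (v, u)) = (\<Sum>u\<in>out_neighbours D v. w0 (v, u))"
      using pair_finite_verts
      by (intro sum.mono_neutral_right) (auto simp: out_neighbours_def w0_def dest: in_arcsD2)
    also have "\<dots> = weighted_outdegree D w v"
      unfolding weighted_outdegree_def
      by (intro sum.cong) (auto simp: out_neighbours_def w0_def)
    finally show ?thesis using assms(6)[OF that] by simp
  qed
  let ?r = "card (loop_vertices ?V w0)"
  have "1 \<le> W * log 2 (real (n + ?r))"
    unfolding \<open>n = card ?V\<close>
  proof (rule outdegree_le_log)
    show "?V \<noteq> {}" using assms(3,4) by auto
  qed (use pair_finite_verts W0 bnd out assms(2) in \<open>auto simp: w0_def\<close>)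
  also have "\<dots> \<le> W * log 2 (real (n + r))"
  proof -
    \<comment> \<open>Only an inequality, since loops of weight 0 are not counted by
      \<open>loop_vertices\<close>.\<close>
    have "?r \<le> r"
      unfolding \<open>r = card (loops D)\<close>
    proof (rule card_inj_on_le)
      show "inj_on (\<lambda>v. (v, v)) (loop_vertices ?V w0)" by (auto simp: inj_on_def)
      show "(\<lambda>v. (v, v)) ` loop_vertices ?V w0 \<subseteq> loops D"
        by (auto simp: loop_vertices_def w0_def loops_def split: if_splits)
      show "finite (loops D)" using pair_finite_arcs by (simp add: loops_def)
    qed
    then show ?thesis using W0 assms(4) by (intro mult_left_mono) auto
  qed
  finally have WL: "1 \<le> W * log 2 (real (n + r))" .
  \<comment> \<open>Hence the maximum is not the inserted 0 but the weight of an actual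
    cycle.\<close>
  have "W \<noteq> 0" using WL by auto
  moreover have "W \<in> insert 0 (cyclic_weight w0 ` S)"
    unfolding W_def using fin_S by (intro Max_in) auto
  ultimately obtain c where c: "positive_cycle ?V w0 c" and Wc: "W = cyclic_weight w0 c"
    by (auto simp: S_def)
  have sub: "set (cyclic_arcs c) \<subseteq> parcs D"
    using c by (force simp: positive_cycle_def w0_def split: if_splits)
  have "directed_cycle D (cyclic_arcs c)"
    using c sub directed_cycle_cyclic_arcs by (auto simp: positive_cycle_def)
  moreover have "cycle_weight w (cyclic_arcs c) = W"
  proof -
    have "distinct (cyclic_arcs c)"
      using c by (simp add: positive_cycle_def cyclic_arcs_def distinct_zipI1)
    then have "W = (\<Sum>a\<in>set (cyclic_arcs c). w0 a)"
      by (simp add: Wc cyclic_weight_def sum_list_distinct_conv_sum_set)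
    also have "\<dots> = (\<Sum>a\<in>set (cyclic_arcs c). w a)"
      using sub by (intro sum.cong) (auto simp: w0_def)
    finally show ?thesis by (simp add: cycle_weight_def)
  qed
  moreover have "1 / log 2 (real (n + r)) \<le> W"
  proof -
    \<comment> \<open>Otherwise the product with \<open>W\<close> would be at most 0; in particular
      \<open>n + r = 1\<close> is impossible.\<close>
    have "0 < log 2 (real (n + r))"
      using WL W0 by (metis less_le_not_le mult_nonneg_nonpos not_le zero_less_one order_trans)
    then show ?thesis using WL by (simp add: pos_divide_le_eq)
  qed
  ultimately show ?thesis by blast
qed

end
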